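(* Let $(X_t)_{t\ge1}$ be a sequence of random variables such that, for constants $\mu,\sigma^2$ and all $t\ge 1$, $X_t\in[0,1]$, $\mathbb{E}_{t-1}X_t=\mu$ and $\mathbb{V}_{t-1}X_t=\sigma^2$. Let $\alpha\in(0,1)$. For any $[0,1]$-valued predictable sequences $(\widehat\mu_i)_{i\ge1}$ and $(\widehat\sigma_i)_{i\ge1}$, and any $[0,1)$-valued predictable sequence $(\lambda_i)_{i\ge1}$, the sequence of intervals $[0,U_t)$, $t\ge1$, is a $1-\alpha$ (upper) confidence sequence for $\sigma^2$, where $U_t=D_t+R_{t,\alpha}$ with $$D_t=\frac{\sum_{i\le t}\lambda_i(X_i-\widehat\mu_i)^2}{\sum_{i\le t}\lambda_i},\qquad R_{t,\alpha}=\frac{\log(1/\alpha)+\sum_{i\le t}\psi_E(\lambda_i)\left((X_i-\widehat\mu_i)^2-\widehat\sigma_i^2\right)^2}{\sum_{i\le t}\lambda_i}.$$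
   Context: All random variables live on a common probability space with probability $\mathbb{P}$. $\mathcal{F}_t=\sigma(X_1,\dots,X_t)$ is the canonical filtration, with $\mathcal{F}_0$ trivial; $\mathbb{E}_t[\cdot]=\mathbb{E}[\cdot\mid\mathcal{F}_t]$ and $\mathbb{V}_t[\cdot]=\mathbb{V}[\cdot\mid\mathcal{F}_t]$. Relations between random variables hold almost surely. A sequence $(M_i)_{i\ge1}$ is predictable if $M_i$ is $\mathcal{F}_{i-1}$-measurable for all $i\ge1$. A sequence of random sets $(C_t)_{t\ge1}$ is a $1-\alpha$ confidence sequence for $\theta$ if $\mathbb{P}(\forall t\ge1:\theta\in C_t)\ge1-\alpha$. For $\lambda\in[0,1)$, $\psi_E(\lambda)=-\log(1-\lambda)-\lambda$. Convention: $U_t=+\infty$ at times $t$ with $\sum_{i\le t}\lambda_i=0$. *)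

theory Defs
  imports "HOL-Probability.Probability"
begin

(* sigma(X_1, ..., X_t).  The indices start at 1, so X 0 plays no role and the sigma-algebra
   at time 0 is the trivial one.  The measure carried by the result is irrelevant:
   real_cond_exp and borel_measurable only look at its space and sets. *)
definition canonical_filtration ::
    "'a measure \<Rightarrow> (nat \<Rightarrow> 'a \<Rightarrow> real) \<Rightarrow> nat \<Rightarrow> 'a measure" where
  "canonical_filtration M X t =
     sigma (space M) (\<Union>i\<in>{1..t}. {X i -` B \<inter> space M | B. B \<in> sets borel})"

definition predictable :: "(nat \<Rightarrow> 'a measure) \<Rightarrow> (nat \<Rightarrow> 'a \<Rightarrow> real) \<Rightarrow> bool" where
  "predictable F Y \<longleftrightarrow> (\<forall>i\<ge>1. Y i \<in> borel_measurable (F (i - 1)))"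

definition cond_variance :: "'a measure \<Rightarrow> 'a measure \<Rightarrow> ('a \<Rightarrow> real) \<Rightarrow> 'a \<Rightarrow> real" where
  "cond_variance M F Y = real_cond_exp M F (\<lambda>\<omega>. (Y \<omega> - real_cond_exp M F Y \<omega>)\<^sup>2)"

(* The coverage event is required to be measurable, because measure M is 0 on other sets. *)
definition confidence_sequence ::
    "'a measure \<Rightarrow> real \<Rightarrow> 'b \<Rightarrow> (nat \<Rightarrow> 'a \<Rightarrow> 'b set) \<Rightarrow> bool" where
  "confidence_sequence M p \<theta> C \<longleftrightarrow>
     {\<omega> \<in> space M. \<forall>t\<ge>1. \<theta> \<in> C t \<omega>} \<in> sets M \<and>
     measure M {\<omega> \<in> space M. \<forall>t\<ge>1. \<theta> \<in> C t \<omega>} \<ge> p"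

definition psi_E :: "real \<Rightarrow> real" where
  "psi_E l = - ln (1 - l) - l"

definition upper_center ::
    "(nat \<Rightarrow> 'a \<Rightarrow> real) \<Rightarrow> (nat \<Rightarrow> 'a \<Rightarrow> real) \<Rightarrow> (nat \<Rightarrow> 'a \<Rightarrow> real) \<Rightarrow> nat \<Rightarrow> 'a \<Rightarrow> real" where
  "upper_center X mu_hat lam t \<omega> =
     (\<Sum>i=1..t. lam i \<omega> * (X i \<omega> - mu_hat i \<omega>)\<^sup>2) / (\<Sum>i=1..t. lam i \<omega>)"

definition upper_radius ::
    "(nat \<Rightarrow> 'a \<Rightarrow> real) \<Rightarrow> (nat \<Rightarrow> 'a \<Rightarrow> real) \<Rightarrow> (nat \<Rightarrow> 'a \<Rightarrow> real) \<Rightarrow> (nat \<Rightarrow> 'a \<Rightarrow> real) \<Rightarrow>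
     real \<Rightarrow> nat \<Rightarrow> 'a \<Rightarrow> real" where
  "upper_radius X mu_hat sigma_hat lam \<alpha> t \<omega> =
     (ln (1 / \<alpha>)
        + (\<Sum>i=1..t. psi_E (lam i \<omega>) * ((X i \<omega> - mu_hat i \<omega>)\<^sup>2 - (sigma_hat i \<omega>)\<^sup>2)\<^sup>2))
     / (\<Sum>i=1..t. lam i \<omega>)"

definition upper_limit ::
    "(nat \<Rightarrow> 'a \<Rightarrow> real) \<Rightarrow> (nat \<Rightarrow> 'a \<Rightarrow> real) \<Rightarrow> (nat \<Rightarrow> 'a \<Rightarrow> real) \<Rightarrow> (nat \<Rightarrow> 'a \<Rightarrow> real) \<Rightarrow>
     real \<Rightarrow> nat \<Rightarrow> 'a \<Rightarrow> ereal" where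
  "upper_limit X mu_hat sigma_hat lam \<alpha> t \<omega> =
     (if (\<Sum>i=1..t. lam i \<omega>) = 0 then \<infinity>
      else ereal (upper_center X mu_hat lam t \<omega> + upper_radius X mu_hat sigma_hat lam \<alpha> t \<omega>))"

end

theory Submission
  imports Defs
begin

text \<open>
  Write \<open>Y\<^sub>i = (X\<^sub>i - mu_hat\<^sub>i)\<^sup>2\<close> and \<open>v\<^sub>i = sigma_hat\<^sub>i\<^sup>2\<close>.  After clearing the denominator
  \<open>\<Sum>i\<le>t. lam\<^sub>i\<close>, the interval at time \<open>t\<close> can miss \<open>\<sigma>\<^sup>2\<close> only if
  \<open>P\<^sub>t = exp (\<Sum>i\<le>t. lam\<^sub>i * (\<sigma>\<^sup>2 - Y\<^sub>i) - psi_E lam\<^sub>i * (Y\<^sub>i - v\<^sub>i)\<^sup>2)\<close> reaches \<open>1 / \<alpha>\<close>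
  (\<open>less_upper_limitI\<close>).  The process \<open>P\<close> is a nonnegative supermartingale that starts at 1, so by
  \<open>Ville_inequality\<close> it ever reaches \<open>1 / \<alpha>\<close> with probability at most \<open>\<alpha>\<close>.

  The supermartingale property rests on two facts.  Squared deviations from a predictable centre
  overestimate the conditional variance: the conditional mean of \<open>Y\<^sub>i\<close> is \<open>\<sigma>\<^sup>2\<close> plus the square
  of the bias of \<open>mu_hat\<^sub>i\<close> (\<open>real_cond_exp_square_centered\<close>).  And for any random variable with values
  in the unit interval whose conditional mean is at least \<open>s\<close>, the factor that enters \<open>P\<close>, with
  \<open>s\<close> in place of \<open>\<sigma>\<^sup>2\<close>, has conditional mean at most 1
  (\<open>real_cond_exp_exp_sub_psi_E_le_1\<close>).  This follows from the scalar inequality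
  \<open>exp_sub_psi_E_le_linear\<close>, which replaces the exponential by an affine function of
  \<open>Y\<^sub>i\<close>.  That inequality holds for every argument not below \<open>-1\<close>, and is applied to
  \<open>v\<^sub>i - Y\<^sub>i\<close>; this is why any predictable guess \<open>v\<^sub>i\<close> in the unit interval is admissible.
\<close>

section \<open>An exponential inequality and its conditional form\<close>

lemma psi_E_nonneg:
  assumes "0 \<le> l" "l < 1"
  shows "0 \<le> psi_E l"
  using ln_le_minus_one[of "1 - l"] assms by (simp add: psi_E_def)

text \<open>
  Fan's inequality.  For fixed \<open>x\<close>, the logarithm of the right side minus that of the left side vanishes at
  \<open>l = 0\<close>, and its derivative in \<open>l\<close> is \<open>l * x\<^sup>2 * (1 / (1 - l) - 1 / (1 + l * x))\<close>, which is
  nonnegative because \<open>x \<ge> -1\<close> gives \<open>1 - l \<le> 1 + l * x\<close>.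
\<close>

lemma exp_sub_psi_E_le_linear:
  assumes l: "0 \<le> l" "l < 1" and x: "-1 \<le> x"
  shows "exp (l * x - psi_E l * x\<^sup>2) \<le> 1 + l * x"
proof -
  define h where "h u = ln (1 + u * x) - u * x + psi_E u * x\<^sup>2" for u
  have pos: "0 < 1 - u \<and> 1 - u \<le> 1 + u * x" if "0 \<le> u" "u \<le> l" for u
    using mult_left_mono[OF x \<open>0 \<le> u\<close>] that l by simp
  have "h 0 \<le> h l"
  proof (rule DERIV_nonneg_imp_nondecreasing[OF l(1)])
    fix u assume u: "0 \<le> u" "u \<le> l"
    note p = pos[OF u]
    have "(h has_real_derivative (x / (1 + u * x) - x + (1 / (1 - u) - 1) * x\<^sup>2)) (at u)"
      unfolding h_def psi_E_def using p by (auto intro!: derivative_eq_intros)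
    moreover have "x / (1 + u * x) - x + (1 / (1 - u) - 1) * x\<^sup>2
        = u * x\<^sup>2 * (1 / (1 - u) - 1 / (1 + u * x))"
    proof -
      have 1: "x / (1 + u * x) - x = - (u * x\<^sup>2 * (1 / (1 + u * x)))"
        using p by (simp add: field_simps power2_eq_square)
      have 2: "1 / (1 - u) - 1 = u * (1 / (1 - u))"
        using p by (simp add: field_simps)
      show ?thesis
        unfolding 1 2 by (simp only: algebra_simps)
    qed
    moreover have "0 \<le> u * x\<^sup>2 * (1 / (1 - u) - 1 / (1 + u * x))"
      using u p by (intro mult_nonneg_nonneg) (auto simp: frac_le)
    ultimately show "\<exists>y. (h has_real_derivative y) (at u) \<and> 0 \<le> y"
      by (intro exI[of _ "x / (1 + u * x) - x + (1 / (1 - u) - 1) * x\<^sup>2"]) simp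
  qed
  then have "l * x - psi_E l * x\<^sup>2 \<le> ln (1 + l * x)"
    by (simp add: h_def psi_E_def)
  moreover have "0 < 1 + l * x"
    using pos[of l] l by simp
  ultimately show ?thesis
    by (metis exp_le_cancel_iff exp_ln)
qed

text \<open>
  The bias-variance decomposition, conditionally on \<open>F\<close>: with \<open>e\<close> the conditional mean of \<open>X\<close>,
  the cross term of \<open>((X - e) + (e - m))\<^sup>2\<close> has conditional mean zero since \<open>e - m\<close> is
  \<open>F\<close>-measurable.  The bound \<open>B\<close> serves to make every term integrable.
\<close>

lemma (in finite_measure_subalgebra) real_cond_exp_square_centered:
  assumes X [measurable]: "X \<in> borel_measurable M" and m [measurable]: "m \<in> borel_measurable F"
    and X_bd: "AE \<omega> in M. \<bar>X \<omega>\<bar> \<le> B" and m_bd: "AE \<omega> in M. \<bar>m \<omega>\<bar> \<le> B"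
  shows "AE \<omega> in M. real_cond_exp M F (\<lambda>\<omega>. (X \<omega> - m \<omega>)\<^sup>2) \<omega>
           = cond_variance M F X \<omega> + (real_cond_exp M F X \<omega> - m \<omega>)\<^sup>2"
proof -
  define e where "e = real_cond_exp M F X"
  have e [measurable]: "e \<in> borel_measurable F"
    by (simp add: e_def)
  have [measurable]: "m \<in> borel_measurable M" "e \<in> borel_measurable M"
    by (rule measurable_from_subalg[OF subalg m] measurable_from_subalg[OF subalg e])+
  have int_X: "integrable M X"
    by (rule integrable_const_bound[of _ B]) (use X_bd in auto)
  have "AE \<omega> in M. e \<omega> \<le> B"
    unfolding e_def by (rule real_cond_exp_le_c) (use X_bd int_X in auto)
  moreover have "AE \<omega> in M. - B \<le> e \<omega>"
    unfolding e_def by (rule real_cond_exp_ge_c) (use X_bd int_X in auto)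
  ultimately have e_bd: "AE \<omega> in M. \<bar>e \<omega>\<bar> \<le> B"
    by eventually_elim auto
  have prod_bd: "\<bar>(a - b) * (c - d)\<bar> \<le> (2 * B) * (2 * B)"
    if "\<bar>a\<bar> \<le> B" "\<bar>b\<bar> \<le> B" "\<bar>c\<bar> \<le> B" "\<bar>d\<bar> \<le> B" for a b c d :: real
    unfolding abs_mult using that by (intro mult_mono) auto
  have bds: "AE \<omega> in M. \<bar>X \<omega>\<bar> \<le> B \<and> \<bar>e \<omega>\<bar> \<le> B \<and> \<bar>m \<omega>\<bar> \<le> B"
    using X_bd e_bd m_bd by eventually_elim simp
  have int1: "integrable M (\<lambda>\<omega>. (X \<omega> - e \<omega>)\<^sup>2)"
    by (rule integrable_const_bound[of _ "(2 * B) * (2 * B)"], use bds in eventually_elim)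
       (unfold real_norm_def power2_eq_square, intro prod_bd, auto)
  have int2: "integrable M (\<lambda>\<omega>. (e \<omega> - m \<omega>) * (X \<omega> - e \<omega>))"
    by (rule integrable_const_bound[of _ "(2 * B) * (2 * B)"], use bds in eventually_elim)
       (unfold real_norm_def power2_eq_square, intro prod_bd, auto)
  have int3: "integrable M (\<lambda>\<omega>. (e \<omega> - m \<omega>)\<^sup>2)"
    by (rule integrable_const_bound[of _ "(2 * B) * (2 * B)"], use bds in eventually_elim)
       (unfold real_norm_def power2_eq_square, intro prod_bd, auto)
  have int_e: "integrable M e"
    unfolding e_def using int_X by (rule real_cond_exp_int)
  have split: "(\<lambda>\<omega>. (X \<omega> - m \<omega>)\<^sup>2)
      = (\<lambda>\<omega>. ((X \<omega> - e \<omega>)\<^sup>2 + 2 * ((e \<omega> - m \<omega>) * (X \<omega> - e \<omega>))) + (e \<omega> - m \<omega>)\<^sup>2)"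
    by (rule ext) (simp add: power2_eq_square algebra_simps)
  have a1: "AE \<omega> in M. real_cond_exp M F (\<lambda>\<omega>. (X \<omega> - m \<omega>)\<^sup>2) \<omega>
      = real_cond_exp M F (\<lambda>\<omega>. (X \<omega> - e \<omega>)\<^sup>2 + 2 * ((e \<omega> - m \<omega>) * (X \<omega> - e \<omega>))) \<omega>
        + real_cond_exp M F (\<lambda>\<omega>. (e \<omega> - m \<omega>)\<^sup>2) \<omega>"
    unfolding split using int1 int2 int3 by (intro real_cond_exp_add) auto
  have a2: "AE \<omega> in M. real_cond_exp M F (\<lambda>\<omega>. (X \<omega> - e \<omega>)\<^sup>2 + 2 * ((e \<omega> - m \<omega>) * (X \<omega> - e \<omega>))) \<omega>
      = real_cond_exp M F (\<lambda>\<omega>. (X \<omega> - e \<omega>)\<^sup>2) \<omega>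
        + real_cond_exp M F (\<lambda>\<omega>. 2 * ((e \<omega> - m \<omega>) * (X \<omega> - e \<omega>))) \<omega>"
    using int1 int2 by (intro real_cond_exp_add) auto
  have a3: "AE \<omega> in M. real_cond_exp M F (\<lambda>\<omega>. 2 * ((e \<omega> - m \<omega>) * (X \<omega> - e \<omega>))) \<omega>
      = 2 * real_cond_exp M F (\<lambda>\<omega>. (e \<omega> - m \<omega>) * (X \<omega> - e \<omega>)) \<omega>"
    using int2 by (rule real_cond_exp_cmult)
  have a4: "AE \<omega> in M. real_cond_exp M F (\<lambda>\<omega>. (e \<omega> - m \<omega>) * (X \<omega> - e \<omega>)) \<omega>
      = (e \<omega> - m \<omega>) * real_cond_exp M F (\<lambda>\<omega>. X \<omega> - e \<omega>) \<omega>"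
    using int2 by (intro real_cond_exp_mult) auto
  have a5: "AE \<omega> in M. real_cond_exp M F (\<lambda>\<omega>. X \<omega> - e \<omega>) \<omega> = e \<omega> - real_cond_exp M F e \<omega>"
    using real_cond_exp_diff[OF int_X int_e] by (simp add: e_def)
  have a6: "AE \<omega> in M. real_cond_exp M F e \<omega> = e \<omega>"
    using int_e e by (rule real_cond_exp_F_meas)
  have a7: "AE \<omega> in M. real_cond_exp M F (\<lambda>\<omega>. (e \<omega> - m \<omega>)\<^sup>2) \<omega> = (e \<omega> - m \<omega>)\<^sup>2"
    using int3 by (rule real_cond_exp_F_meas) measurable
  show ?thesis
    using a1 a2 a3 a4 a5 a6 a7
    by eventually_elim (simp add: cond_variance_def e_def)
qed

text \<open>
  Factoring out the \<open>F\<close>-measurable weight \<open>W = exp (l * (s - v))\<close> recentres the exponent from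
  \<open>s\<close> to \<open>v\<close>, so that Fan's inequality bounds the integrand by \<open>W * (1 + l * (v - Y))\<close>.  This is
  affine in \<open>Y\<close>, hence its conditional mean is at most \<open>W * (1 + l * (v - s))\<close>, and
  \<open>1 + z \<le> exp z\<close> cancels the weight.
\<close>

lemma (in finite_measure_subalgebra) real_cond_exp_exp_sub_psi_E_le_1:
  assumes Y [measurable]: "Y \<in> borel_measurable M"
    and v [measurable]: "v \<in> borel_measurable F" and l [measurable]: "l \<in> borel_measurable F"
    and Y_bd: "AE \<omega> in M. Y \<omega> \<in> {0..1}" and v_bd: "AE \<omega> in M. v \<omega> \<in> {0..1}"
    and l_bd: "AE \<omega> in M. l \<omega> \<in> {0..<1}"
    and mean: "AE \<omega> in M. s \<le> real_cond_exp M F Y \<omega>"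
  shows "AE \<omega> in M. real_cond_exp M F
           (\<lambda>\<omega>. exp (l \<omega> * (s - Y \<omega>) - psi_E (l \<omega>) * (Y \<omega> - v \<omega>)\<^sup>2)) \<omega> \<le> 1"
proof -
  define W where "W \<omega> = exp (l \<omega> * (s - v \<omega>))" for \<omega>
  define g where "g \<omega> = exp (l \<omega> * (s - Y \<omega>) - psi_E (l \<omega>) * (Y \<omega> - v \<omega>)\<^sup>2)" for \<omega>
  have [measurable]: "v \<in> borel_measurable M" "l \<in> borel_measurable M"
    by (rule measurable_from_subalg[OF subalg v] measurable_from_subalg[OF subalg l])+
  have W [measurable]: "W \<in> borel_measurable F" "W \<in> borel_measurable M"
    unfolding W_def by measurable
  have g [measurable]: "g \<in> borel_measurable M"
    unfolding g_def psi_E_def by measurable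
  have W_bd: "AE \<omega> in M. W \<omega> \<le> exp (\<bar>s\<bar> + 1)"
    using v_bd l_bd
  proof eventually_elim
    case (elim \<omega>)
    have "l \<omega> * (s - v \<omega>) \<le> \<bar>l \<omega>\<bar> * \<bar>s - v \<omega>\<bar>"
      by (metis abs_ge_self abs_mult)
    also have "\<dots> \<le> 1 * (\<bar>s\<bar> + 1)"
      using elim by (intro mult_mono) auto
    finally show ?case by (simp add: W_def)
  qed
  have g_le: "AE \<omega> in M. g \<omega> \<le> W \<omega> * (1 + l \<omega> * v \<omega>) - (W \<omega> * l \<omega>) * Y \<omega>"
    using Y_bd v_bd l_bd
  proof eventually_elim
    case (elim \<omega>)
    have "g \<omega> = W \<omega> * exp (l \<omega> * (v \<omega> - Y \<omega>) - psi_E (l \<omega>) * (v \<omega> - Y \<omega>)\<^sup>2)"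
      unfolding g_def W_def exp_add[symmetric] by (simp add: algebra_simps power2_commute)
    also have "\<dots> \<le> W \<omega> * (1 + l \<omega> * (v \<omega> - Y \<omega>))"
      using elim by (intro mult_left_mono exp_sub_psi_E_le_linear) (auto simp: W_def)
    finally show ?case by (simp add: algebra_simps)
  qed
  have int_1: "integrable M (\<lambda>\<omega>. W \<omega> * (1 + l \<omega> * v \<omega>))"
  proof (rule integrable_const_bound[of _ "exp (\<bar>s\<bar> + 1) * (1 + 1 * 1)"])
    show "AE \<omega> in M. norm (W \<omega> * (1 + l \<omega> * v \<omega>)) \<le> exp (\<bar>s\<bar> + 1) * (1 + 1 * 1)"
      using W_bd v_bd l_bd
    proof eventually_elim
      case (elim \<omega>)
      have "W \<omega> * (1 + l \<omega> * v \<omega>) \<le> exp (\<bar>s\<bar> + 1) * (1 + 1 * 1)"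
        using elim by (intro mult_mono add_mono) (auto simp: W_def)
      moreover have "0 \<le> W \<omega> * (1 + l \<omega> * v \<omega>)"
        using elim by (auto simp: W_def)
      ultimately show ?case by simp
    qed
  qed measurable
  have int_2: "integrable M (\<lambda>\<omega>. (W \<omega> * l \<omega>) * Y \<omega>)"
  proof (rule integrable_const_bound[of _ "exp (\<bar>s\<bar> + 1) * 1 * 1"])
    show "AE \<omega> in M. norm ((W \<omega> * l \<omega>) * Y \<omega>) \<le> exp (\<bar>s\<bar> + 1) * 1 * 1"
      using W_bd Y_bd l_bd
    proof eventually_elim
      case (elim \<omega>)
      have "W \<omega> * l \<omega> * Y \<omega> \<le> exp (\<bar>s\<bar> + 1) * 1 * 1"
        using elim by (intro mult_mono) (auto simp: W_def)
      moreover have "0 \<le> W \<omega> * l \<omega> * Y \<omega>"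
        using elim by (auto simp: W_def)
      ultimately show ?case by simp
    qed
  qed measurable
  have int_g: "integrable M g"
    by (rule Bochner_Integration.integrable_bound[OF Bochner_Integration.integrable_diff[OF int_1 int_2]])
       (use g_le in \<open>measurable, eventually_elim, auto simp: g_def\<close>)
  have b1: "AE \<omega> in M. real_cond_exp M F g \<omega>
      \<le> real_cond_exp M F (\<lambda>\<omega>. W \<omega> * (1 + l \<omega> * v \<omega>) - (W \<omega> * l \<omega>) * Y \<omega>) \<omega>"
    using g_le int_g Bochner_Integration.integrable_diff[OF int_1 int_2] by (rule real_cond_exp_mono)
  have b2: "AE \<omega> in M. real_cond_exp M F (\<lambda>\<omega>. W \<omega> * (1 + l \<omega> * v \<omega>) - (W \<omega> * l \<omega>) * Y \<omega>) \<omega>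
      = real_cond_exp M F (\<lambda>\<omega>. W \<omega> * (1 + l \<omega> * v \<omega>)) \<omega> - real_cond_exp M F (\<lambda>\<omega>. (W \<omega> * l \<omega>) * Y \<omega>) \<omega>"
    using int_1 int_2 by (rule real_cond_exp_diff)
  have b3: "AE \<omega> in M. real_cond_exp M F (\<lambda>\<omega>. W \<omega> * (1 + l \<omega> * v \<omega>)) \<omega> = W \<omega> * (1 + l \<omega> * v \<omega>)"
    using int_1 by (rule real_cond_exp_F_meas) measurable
  have b4: "AE \<omega> in M. real_cond_exp M F (\<lambda>\<omega>. (W \<omega> * l \<omega>) * Y \<omega>) \<omega>
      = (W \<omega> * l \<omega>) * real_cond_exp M F Y \<omega>"
    using int_2 by (intro real_cond_exp_mult) auto
  have "AE \<omega> in M. real_cond_exp M F g \<omega> \<le> 1"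
    using b1 b2 b3 b4 mean l_bd
  proof eventually_elim
    case (elim \<omega>)
    have "(W \<omega> * l \<omega>) * s \<le> (W \<omega> * l \<omega>) * real_cond_exp M F Y \<omega>"
      using elim by (intro mult_left_mono) (auto simp: W_def)
    then have "real_cond_exp M F g \<omega> \<le> W \<omega> * (1 + - (l \<omega> * (s - v \<omega>)))"
      using elim by (simp add: algebra_simps)
    also have "\<dots> \<le> W \<omega> * exp (- (l \<omega> * (s - v \<omega>)))"
      by (intro mult_left_mono exp_ge_add_one_self) (simp add: W_def)
    also have "\<dots> = 1"
      by (simp add: W_def exp_minus)
    finally show ?case .
  qed
  then show ?thesis
    by (simp add: g_def[abs_def])
qed

section \<open>Ville's maximal inequality\<close>

text \<open>
  Stop \<open>P\<close> when it first reaches \<open>c\<close>, and cap it at \<open>c\<close> from then on.  The capped process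
  \<open>Q\<close> has nonincreasing expectation: only paths that have not yet crossed still move, the event
  \<open>A n\<close> that no crossing has occurred belongs to \<open>F n\<close>, and capping only lowers the value.
  Since \<open>Q\<close> equals \<open>c\<close> on the paths that have crossed, this bounds the probability of
  crossing by any finite time; then let the time tend to infinity.
\<close>

lemma (in prob_space) Ville_inequality:
  assumes sub: "\<And>n. subalgebra M (F n)" and mono: "\<And>m n. m \<le> n \<Longrightarrow> subalgebra (F n) (F m)"
    and adapted: "\<And>n. P n \<in> borel_measurable (F n)"
    and int: "\<And>n. integrable M (P n)" and nonneg: "\<And>n \<omega>. 0 \<le> P n \<omega>"
    and super: "\<And>n. AE \<omega> in M. real_cond_exp M (F n) (P (Suc n)) \<omega> \<le> P n \<omega>"
    and c: "0 < c"
  shows "prob {\<omega> \<in> space M. \<exists>n. c \<le> P n \<omega>} \<le> expectation (P 0) / c"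
proof -
  define A where "A n = {\<omega> \<in> space M. \<forall>k\<le>n. P k \<omega> < c}" for n
  define Q where "Q n \<omega> = indicat_real (A n) \<omega> * P n \<omega> + c * indicat_real (space M - A n) \<omega>" for n \<omega>
  have P_meas [measurable]: "P n \<in> borel_measurable M" for n
    using int by (rule borel_measurable_integrable)
  have A_F: "A n \<in> sets (F n)" for n
  proof -
    have [measurable]: "P k \<in> borel_measurable (F n)" if "k \<le> n" for k
      using measurable_from_subalg[OF mono[OF that] adapted] .
    have "{\<omega> \<in> space (F n). \<forall>k\<in>{..n}. P k \<omega> < c} \<in> sets (F n)"
      by (intro sets.sets_Collect_finite_All) auto
    moreover have "space (F n) = space M"
      using sub by (simp add: subalgebra_def)
    ultimately show ?thesis
      by (simp only: A_def Ball_def atMost_iff)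
  qed
  have A_M [measurable]: "A n \<in> sets M" for n
    using A_F sub by (auto simp: subalgebra_def)
  have int_ind: "integrable M (\<lambda>\<omega>. indicat_real (A n) \<omega> * P k \<omega>)" for n k
    using integrable_mult_indicator[OF A_M int] by simp
  have int_c: "integrable M (\<lambda>\<omega>. c * indicat_real (space M - A n) \<omega>)" for n
    by (intro integrable_mult_right integrable_real_indicator) (auto simp: less_top[symmetric])
  have int_Q: "integrable M (Q n)" for n
    unfolding Q_def using int_ind int_c by (intro Bochner_Integration.integrable_add)
  have Q_le: "expectation (Q n) \<le> expectation (P 0)" for n
  proof (induction n)
    case 0
    show ?case
      by (rule integral_mono[OF int_Q int]) (auto simp: Q_def A_def indicator_def)
  next
    case (Suc n)
    interpret FMS: finite_measure_subalgebra M "F n"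
      by unfold_locales (rule sub)
    have "expectation (Q (Suc n))
        \<le> expectation (\<lambda>\<omega>. indicat_real (A n) \<omega> * P (Suc n) \<omega> + c * indicat_real (space M - A n) \<omega>)"
      by (rule integral_mono[OF int_Q Bochner_Integration.integrable_add[OF int_ind int_c]])
         (auto simp: Q_def A_def indicator_def le_Suc_eq nonneg not_less)
    also have "\<dots> = expectation (\<lambda>\<omega>. indicat_real (A n) \<omega> * P (Suc n) \<omega>)
        + expectation (\<lambda>\<omega>. c * indicat_real (space M - A n) \<omega>)"
      by (rule Bochner_Integration.integral_add[OF int_ind int_c])
    also have "expectation (\<lambda>\<omega>. indicat_real (A n) \<omega> * P (Suc n) \<omega>)
        = expectation (\<lambda>\<omega>. indicat_real (A n) \<omega> * real_cond_exp M (F n) (P (Suc n)) \<omega>)"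
      using FMS.real_cond_exp_intA[OF int A_F] by (simp add: set_lebesgue_integral_def)
    also have "\<dots> \<le> expectation (\<lambda>\<omega>. indicat_real (A n) \<omega> * P n \<omega>)"
    proof (rule integral_mono_AE[OF _ int_ind])
      show "integrable M (\<lambda>\<omega>. indicat_real (A n) \<omega> * real_cond_exp M (F n) (P (Suc n)) \<omega>)"
        using integrable_mult_indicator[OF A_M FMS.real_cond_exp_int(1)[OF int]] by simp
      show "AE \<omega> in M. indicat_real (A n) \<omega> * real_cond_exp M (F n) (P (Suc n)) \<omega>
          \<le> indicat_real (A n) \<omega> * P n \<omega>"
        using super[of n] by eventually_elim (auto intro: mult_left_mono)
    qed
    also have "expectation (\<lambda>\<omega>. indicat_real (A n) \<omega> * P n \<omega>)
        + expectation (\<lambda>\<omega>. c * indicat_real (space M - A n) \<omega>) = expectation (Q n)"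
      unfolding Q_def by (rule Bochner_Integration.integral_add[OF int_ind int_c, symmetric])
    finally show ?case
      using Suc.IH by simp
  qed
  have crossed: "prob (space M - A n) \<le> expectation (P 0) / c" for n
  proof -
    have "c * prob (space M - A n) = expectation (\<lambda>\<omega>. c * indicat_real (space M - A n) \<omega>)"
      by simp
    also have "\<dots> \<le> expectation (Q n)"
      by (rule integral_mono[OF int_c int_Q]) (simp add: Q_def nonneg)
    finally show ?thesis
      using Q_le[of n] c by (simp add: field_simps)
  qed
  have "(\<lambda>n. prob (space M - A n)) \<longlonglongrightarrow> prob (\<Union>n. space M - A n)"
    by (rule finite_Lim_measure_incseq) (auto simp: incseq_def A_def)
  then have "prob (\<Union>n. space M - A n) \<le> expectation (P 0) / c"
    by (rule LIMSEQ_le_const2) (use crossed in auto)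
  moreover have "(\<Union>n. space M - A n) = {\<omega> \<in> space M. \<exists>n. c \<le> P n \<omega>}"
    by (auto simp: A_def not_less) (meson leD order_refl)
  ultimately show ?thesis by simp
qed

section \<open>The canonical filtration\<close>

lemma space_canonical_filtration [simp]: "space (canonical_filtration M X t) = space M"
  by (auto simp: canonical_filtration_def intro!: space_measure_of)

lemma sets_canonical_filtration:
  "sets (canonical_filtration M X t)
     = sigma_sets (space M) (\<Union>i\<in>{1..t}. {X i -` B \<inter> space M | B. B \<in> sets borel})"
  unfolding canonical_filtration_def by (rule sets_measure_of) auto

lemma subalgebra_canonical_filtration_mono:
  "m \<le> n \<Longrightarrow> subalgebra (canonical_filtration M X n) (canonical_filtration M X m)"
  unfolding subalgebra_def sets_canonical_filtration
  by (intro conjI sigma_sets_mono' UN_mono) auto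

lemma subalgebra_canonical_filtration:
  assumes "\<And>t. t \<ge> 1 \<Longrightarrow> X t \<in> borel_measurable M"
  shows "subalgebra M (canonical_filtration M X t)"
  unfolding subalgebra_def sets_canonical_filtration
  using assms by (auto intro!: sets.sigma_sets_subset measurable_sets)

lemma measurable_canonical_filtration:
  assumes "1 \<le> i" "i \<le> t"
  shows "X i \<in> borel_measurable (canonical_filtration M X t)"
proof (rule measurableI)
  fix B :: "real set"
  assume "B \<in> sets borel"
  then show "X i -` B \<inter> space (canonical_filtration M X t) \<in> sets (canonical_filtration M X t)"
    using assms unfolding sets_canonical_filtration by (intro sigma_sets.Basic UN_I[of i]) auto
qed simp

section \<open>The confidence sequence\<close>

text \<open>
  The pathwise link between the supermartingale and the upper limit.  If all weights up to time
  \<open>t\<close> vanish the upper limit is infinite; otherwise take logarithms and divide by the sum of the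
  weights.
\<close>

lemma less_upper_limitI:
  assumes "0 < \<alpha>" and "\<And>i. 1 \<le> i \<Longrightarrow> 0 \<le> lam i \<omega>"
    and below: "exp (\<Sum>i=1..t. lam i \<omega> * (x - (X i \<omega> - mu_hat i \<omega>)\<^sup>2)
             - psi_E (lam i \<omega>) * ((X i \<omega> - mu_hat i \<omega>)\<^sup>2 - (sigma_hat i \<omega>)\<^sup>2)\<^sup>2) < 1 / \<alpha>"
  shows "ereal x < upper_limit X mu_hat sigma_hat lam \<alpha> t \<omega>"
proof -
  define S where "S = (\<Sum>i=1..t. lam i \<omega>)"
  define D where "D = (\<Sum>i=1..t. lam i \<omega> * (X i \<omega> - mu_hat i \<omega>)\<^sup>2)"
  define V where "V =
    (\<Sum>i=1..t. psi_E (lam i \<omega>) * ((X i \<omega> - mu_hat i \<omega>)\<^sup>2 - (sigma_hat i \<omega>)\<^sup>2)\<^sup>2)"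
  have "(\<Sum>i=1..t. lam i \<omega> * (x - (X i \<omega> - mu_hat i \<omega>)\<^sup>2)
             - psi_E (lam i \<omega>) * ((X i \<omega> - mu_hat i \<omega>)\<^sup>2 - (sigma_hat i \<omega>)\<^sup>2)\<^sup>2) = S * x - D - V"
    by (simp add: S_def D_def V_def right_diff_distrib sum_subtractf sum_distrib_right)
  with below have "exp (S * x - D - V) < 1 / \<alpha>"
    by simp
  then have less: "S * x < D + (ln (1 / \<alpha>) + V)"
    using assms(1) by (subst (asm) ln_less_cancel_iff[symmetric]) auto
  have "0 \<le> S"
    unfolding S_def using assms(2) by (intro sum_nonneg) auto
  then show ?thesis
    using less unfolding upper_limit_def upper_center_def upper_radius_def
      S_def[symmetric] D_def[symmetric] V_def[symmetric]
    by (auto simp: add_divide_distrib[symmetric] field_simps)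
qed


theorem corollary4p3:
  fixes M :: "'a measure"
    and X mu_hat sigma_hat lam :: "nat \<Rightarrow> 'a \<Rightarrow> real"
    and \<mu> \<sigma> \<alpha> :: real
  defines "F \<equiv> canonical_filtration M X"
  assumes "prob_space M"
    and "\<And>t. t \<ge> 1 \<Longrightarrow> X t \<in> borel_measurable M"
    and "\<And>t. t \<ge> 1 \<Longrightarrow> AE \<omega> in M. X t \<omega> \<in> {0..1}"
    and "\<And>t. t \<ge> 1 \<Longrightarrow> AE \<omega> in M. real_cond_exp M (F (t - 1)) (X t) \<omega> = \<mu>"
    and "\<And>t. t \<ge> 1 \<Longrightarrow> AE \<omega> in M. cond_variance M (F (t - 1)) (X t) \<omega> = \<sigma>\<^sup>2"
    and "\<alpha> \<in> {0<..<1}"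
    and "predictable F mu_hat"
    and "\<And>i. i \<ge> 1 \<Longrightarrow> AE \<omega> in M. mu_hat i \<omega> \<in> {0..1}"
    and "predictable F sigma_hat"
    and "\<And>i. i \<ge> 1 \<Longrightarrow> AE \<omega> in M. sigma_hat i \<omega> \<in> {0..1}"
    and "predictable F lam"
    and "\<And>i. i \<ge> 1 \<Longrightarrow> AE \<omega> in M. lam i \<omega> \<in> {0..<1}"
  shows "confidence_sequence M (1 - \<alpha>) (\<sigma>\<^sup>2)
           (\<lambda>t \<omega>. {x::real. ereal x \<in> {0..<upper_limit X mu_hat sigma_hat lam \<alpha> t \<omega>}})"
proof -
  interpret prob_space M by fact
  note X_meas = assms(3) and X_bd = assms(4) and X_var = assms(6)
    and \<alpha> = assms(7) and mu_pred = assms(8) and mu_bd = assms(9)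
    and sigma_pred = assms(10) and sigma_bd = assms(11) and lam_pred = assms(12) and lam_bd = assms(13)
  define Y where "Y i \<omega> = (X i \<omega> - mu_hat i \<omega>)\<^sup>2" for i \<omega>
  define v where "v i \<omega> = (sigma_hat i \<omega>)\<^sup>2" for i \<omega>
  define G where "G i \<omega> =
    exp (lam i \<omega> * (\<sigma>\<^sup>2 - Y i \<omega>) - psi_E (lam i \<omega>) * (Y i \<omega> - v i \<omega>)\<^sup>2)" for i \<omega>
  define P where "P t \<omega> =
    exp (\<Sum>i=1..t. lam i \<omega> * (\<sigma>\<^sup>2 - Y i \<omega>) - psi_E (lam i \<omega>) * (Y i \<omega> - v i \<omega>)\<^sup>2)" for t \<omega>
  have sub: "subalgebra M (F t)" for t
    unfolding F_def using X_meas by (rule subalgebra_canonical_filtration)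
  have mono: "subalgebra (F n) (F m)" if "m \<le> n" for m n
    unfolding F_def using that by (rule subalgebra_canonical_filtration_mono)
  have pred: "Z i \<in> borel_measurable (F t)" if "predictable F Z" "1 \<le> i" "i \<le> Suc t"
    for Z :: "nat \<Rightarrow> 'a \<Rightarrow> real" and i t
    by (rule measurable_from_subalg[OF mono[of "i - 1"]]) (use that in \<open>auto simp: predictable_def\<close>)
  have pred_M: "Z i \<in> borel_measurable M" if "predictable F Z" "1 \<le> i"
    for Z :: "nat \<Rightarrow> 'a \<Rightarrow> real" and i
    using measurable_from_subalg[OF sub pred[OF that le_SucI[OF order_refl]]] .
  have P_F: "P t \<in> borel_measurable (F t)" for t
  proof -
    have [measurable]: "X i \<in> borel_measurable (F t)" "mu_hat i \<in> borel_measurable (F t)"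
        "sigma_hat i \<in> borel_measurable (F t)" "lam i \<in> borel_measurable (F t)" if "i \<in> {1..t}" for i
      using that mu_pred sigma_pred lam_pred
      by (auto simp: F_def intro: measurable_canonical_filtration pred[unfolded F_def])
    show ?thesis
      unfolding P_def Y_def v_def psi_E_def by measurable
  qed
  have Y_bd: "AE \<omega> in M. Y i \<omega> \<in> {0..1}" if "1 \<le> i" for i
    using X_bd[OF that] mu_bd[OF that]
    by eventually_elim (auto simp: Y_def abs_square_le_1 abs_le_iff)
  have v_bd: "AE \<omega> in M. v i \<omega> \<in> {0..1}" if "1 \<le> i" for i
    using sigma_bd[OF that] by eventually_elim (auto simp: v_def abs_square_le_1)
  \<comment> \<open>Each summand of the exponent is at most \<open>\<sigma>\<^sup>2\<close>, so \<open>P t\<close> is essentially bounded.\<close>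
  have P_int: "integrable M (P t)" for t
  proof (rule integrable_const_bound)
    show "P t \<in> borel_measurable M"
      by (rule measurable_from_subalg[OF sub P_F])
    have "AE \<omega> in M. \<forall>i\<in>{1..t}. Y i \<omega> \<in> {0..1} \<and> lam i \<omega> \<in> {0..<1}"
      using Y_bd lam_bd by (intro AE_finite_allI) auto
    then show "AE \<omega> in M. norm (P t \<omega>) \<le> exp (real t * \<sigma>\<^sup>2)"
    proof eventually_elim
      case (elim \<omega>)
      have "lam i \<omega> * (\<sigma>\<^sup>2 - Y i \<omega>) - psi_E (lam i \<omega>) * (Y i \<omega> - v i \<omega>)\<^sup>2 \<le> \<sigma>\<^sup>2"
        if "i \<in> {1..t}" for i
      proof -
        have "lam i \<omega> * (\<sigma>\<^sup>2 - Y i \<omega>) \<le> lam i \<omega> * \<sigma>\<^sup>2"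
          using elim that by (intro mult_left_mono) auto
        also have "\<dots> \<le> \<sigma>\<^sup>2"
          using elim that by (intro mult_left_le_one_le) (auto intro: less_imp_le)
        finally have "lam i \<omega> * (\<sigma>\<^sup>2 - Y i \<omega>) \<le> \<sigma>\<^sup>2" .
        moreover have "0 \<le> psi_E (lam i \<omega>)"
          using elim that by (intro psi_E_nonneg) auto
        then have "0 \<le> psi_E (lam i \<omega>) * (Y i \<omega> - v i \<omega>)\<^sup>2"
          by simp
        ultimately show ?thesis by linarith
      qed
      then have "(\<Sum>i=1..t. lam i \<omega> * (\<sigma>\<^sup>2 - Y i \<omega>) - psi_E (lam i \<omega>) * (Y i \<omega> - v i \<omega>)\<^sup>2) \<le> (\<Sum>i=1..t. \<sigma>\<^sup>2)"
        by (intro sum_mono)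
      then show ?case by (simp add: P_def)
    qed
  qed
  have super: "AE \<omega> in M. real_cond_exp M (F t) (P (Suc t)) \<omega> \<le> P t \<omega>" for t
  proof -
    interpret FMS: finite_measure_subalgebra M "F t"
      by unfold_locales (rule sub)
    have i: "1 \<le> Suc t" by simp
    have [measurable]: "X (Suc t) \<in> borel_measurable M" "mu_hat (Suc t) \<in> borel_measurable M"
        "sigma_hat (Suc t) \<in> borel_measurable M" "lam (Suc t) \<in> borel_measurable M"
      using X_meas pred_M mu_pred sigma_pred lam_pred by auto
    have F_meas [measurable]: "mu_hat (Suc t) \<in> borel_measurable (F t)"
        "sigma_hat (Suc t) \<in> borel_measurable (F t)" "lam (Suc t) \<in> borel_measurable (F t)"
      using pred mu_pred sigma_pred lam_pred by auto
    have [measurable]: "Y (Suc t) \<in> borel_measurable M" "v (Suc t) \<in> borel_measurable (F t)"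
        "v (Suc t) \<in> borel_measurable M" "G (Suc t) \<in> borel_measurable M"
      unfolding G_def Y_def v_def psi_E_def by measurable
    have "AE \<omega> in M. real_cond_exp M (F t) (Y (Suc t)) \<omega>
        = cond_variance M (F t) (X (Suc t)) \<omega> + (real_cond_exp M (F t) (X (Suc t)) \<omega> - mu_hat (Suc t) \<omega>)\<^sup>2"
      unfolding Y_def
    proof (rule FMS.real_cond_exp_square_centered[where B = 1])
      show "AE \<omega> in M. \<bar>X (Suc t) \<omega>\<bar> \<le> 1"
        using X_bd[OF i] by eventually_elim auto
      show "AE \<omega> in M. \<bar>mu_hat (Suc t) \<omega>\<bar> \<le> 1"
        using mu_bd[OF i] by eventually_elim auto
    qed measurable
    \<comment> \<open>The squared bias of \<open>mu_hat\<close> has the favourable sign and is dropped.\<close>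
    then have "AE \<omega> in M. \<sigma>\<^sup>2 \<le> real_cond_exp M (F t) (Y (Suc t)) \<omega>"
      using X_var[OF i, simplified] by eventually_elim simp
    then have "AE \<omega> in M. real_cond_exp M (F t) (G (Suc t)) \<omega> \<le> 1"
      unfolding G_def
      by (intro FMS.real_cond_exp_exp_sub_psi_E_le_1 Y_bd v_bd lam_bd) (auto simp: F_meas)
    moreover have P_Suc: "P (Suc t) = (\<lambda>\<omega>. P t \<omega> * G (Suc t) \<omega>)"
      by (simp add: P_def G_def exp_add[symmetric] fun_eq_iff)
    have "AE \<omega> in M. real_cond_exp M (F t) (P (Suc t)) \<omega> = P t \<omega> * real_cond_exp M (F t) (G (Suc t)) \<omega>"
      unfolding P_Suc
      by (rule FMS.real_cond_exp_mult) (use P_F P_int[of "Suc t"] P_Suc in auto)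
    ultimately show ?thesis
      by eventually_elim (auto simp: P_def intro: mult_left_le)
  qed
  have "prob {\<omega> \<in> space M. \<exists>t. 1 / \<alpha> \<le> P t \<omega>} \<le> expectation (P 0) / (1 / \<alpha>)"
    using sub mono P_F P_int _ super
    by (rule Ville_inequality) (use \<alpha> in \<open>auto simp: P_def\<close>)
  also have "expectation (P 0) = 1"
    by (simp add: P_def[abs_def] prob_space)
  finally have Ville: "prob {\<omega> \<in> space M. \<exists>t. 1 / \<alpha> \<le> P t \<omega>} \<le> \<alpha>"
    by simp
  let ?C = "{\<omega> \<in> space M. \<forall>t\<ge>1. ereal (\<sigma>\<^sup>2) < upper_limit X mu_hat sigma_hat lam \<alpha> t \<omega>}"
  have [measurable]: "P t \<in> borel_measurable M" for t
    using P_int by (rule borel_measurable_integrable)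
  have upper_meas [measurable]: "upper_limit X mu_hat sigma_hat lam \<alpha> t \<in> borel_measurable M" for t
  proof -
    have [measurable]: "X i \<in> borel_measurable M" "mu_hat i \<in> borel_measurable M"
        "sigma_hat i \<in> borel_measurable M" "lam i \<in> borel_measurable M" if "i \<in> {1..t}" for i
      using that X_meas pred_M mu_pred sigma_pred lam_pred by auto
    show ?thesis
      unfolding upper_limit_def[abs_def] upper_center_def upper_radius_def psi_E_def by measurable
  qed
  have C_meas: "?C \<in> sets M"
    by measurable
  have "AE \<omega> in M. \<forall>i. 1 \<le> i \<longrightarrow> lam i \<omega> \<in> {0..<1}"
    unfolding AE_all_countable using lam_bd by auto
  then have "AE \<omega> in M. \<omega> \<in> space M - {\<omega> \<in> space M. \<exists>t. 1 / \<alpha> \<le> P t \<omega>} \<longrightarrow> \<omega> \<in> ?C"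
  proof eventually_elim
    case (elim \<omega>)
    show ?case
      using \<alpha> elim less_upper_limitI[of \<alpha> lam \<omega> "\<sigma>\<^sup>2" X mu_hat sigma_hat]
      by (auto simp: P_def Y_def v_def not_le)
  qed
  then have "prob (space M - {\<omega> \<in> space M. \<exists>t. 1 / \<alpha> \<le> P t \<omega>}) \<le> prob ?C"
    using C_meas by (intro finite_measure_mono_AE)
  moreover have "prob (space M - {\<omega> \<in> space M. \<exists>t. 1 / \<alpha> \<le> P t \<omega>}) = 1 - prob {\<omega> \<in> space M. \<exists>t. 1 / \<alpha> \<le> P t \<omega>}"
    by (intro prob_compl) measurable
  ultimately have "1 - \<alpha> \<le> prob ?C"
    using Ville by linarith
  moreover have "{\<omega> \<in> space M. \<forall>t\<ge>1. \<sigma>\<^sup>2 \<in> {x. ereal x \<in> {0..<upper_limit X mu_hat sigma_hat lam \<alpha> t \<omega>}}} = ?C"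
    by (auto simp: zero_ereal_def)
  ultimately show ?thesis
    unfolding confidence_sequence_def using C_meas by simp
qed

end
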